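(* There is an absolute constant $c$ such that the following holds. Let $A$ be a matrix and $k\ge1$ an integer such that $\sigma_{k+1}(A)\le\frac14\sigma_k(A)$. Then, for any matrix $E$ (of the same size as $A$) with $\|E\|_F<\frac14\sigma_k(A)$, $$\|P_k(A+E)-P_k(A)\|_F\ \le\ c\left(\sqrt{k}\,\|E\|_2+\|E\|_F\right).$$
   Context: Matrices are real. $\sigma_j(A)$ is the $j$-th largest singular value of $A$. $P_k(A)$ is the best rank-$k$ approximation of $A$ (truncation of its SVD to the $k$ largest singular values). $\|\cdot\|_2$ is the operator norm and $\|\cdot\|_F$ the Frobenius norm. *)

theory Defs
  imports Complex_Main "Jordan_Normal_Form.Char_Poly"
begin

definition l2_norm_vec :: "real vec \<Rightarrow> real" where
  "l2_norm_vec x = sqrt (x \<bullet> x)"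

(* The bound 1 on the norm (rather than norm equal to 1) keeps the set nonempty when A has no columns. *)
definition op_norm :: "real mat \<Rightarrow> real" where
  "op_norm A = (SUP x \<in> {x \<in> carrier_vec (dim_col A). l2_norm_vec x \<le> 1}. l2_norm_vec (A *\<^sub>v x))"

definition frobenius_norm :: "real mat \<Rightarrow> real" where
  "frobenius_norm A = sqrt (\<Sum>i<dim_row A. \<Sum>j<dim_col A. (A $$ (i,j))\<^sup>2)"

(* Square roots of the eigenvalues of the Gram matrix with algebraic multiplicity, in decreasing
   order. There are dim_col A of them; those past min (dim_row A) (dim_col A) are zero. *)
definition singular_values :: "real mat \<Rightarrow> real list" where
  "singular_values A =
     rev (sorted_list_of_multiset
       (image_mset sqrt (proots (char_poly (transpose_mat A * A)))))"

(* The index j starts at 1. Past the end of the list the singular value is 0 by convention. *)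
definition singular_value :: "nat \<Rightarrow> real mat \<Rightarrow> real" where
  "singular_value j A =
     (if 1 \<le> j \<and> j \<le> length (singular_values A) then singular_values A ! (j - 1) else 0)"

(* orthogonal_mat from Matrix.thy does not ask for columns of norm 1, so orthogonality is spelled out. *)
definition is_svd :: "real mat \<Rightarrow> real mat \<Rightarrow> real mat \<Rightarrow> real mat \<Rightarrow> bool" where
  "is_svd A U S V \<longleftrightarrow>
     U \<in> carrier_mat (dim_row A) (dim_row A) \<and> transpose_mat U * U = 1\<^sub>m (dim_row A) \<and>
     V \<in> carrier_mat (dim_col A) (dim_col A) \<and> transpose_mat V * V = 1\<^sub>m (dim_col A) \<and>
     S \<in> carrier_mat (dim_row A) (dim_col A) \<and> diagonal_mat S \<and>
     (\<forall>i < min (dim_row A) (dim_col A). 0 \<le> S $$ (i,i)) \<and>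
     (\<forall>i j. i \<le> j \<and> j < min (dim_row A) (dim_col A) \<longrightarrow> S $$ (j,j) \<le> S $$ (i,i)) \<and>
     A = U * S * transpose_mat V"

definition truncate_diag :: "nat \<Rightarrow> real mat \<Rightarrow> real mat" where
  "truncate_diag k S =
     mat (dim_row S) (dim_col S) (\<lambda>(i,j). if i < k \<and> j < k then S $$ (i,j) else 0)"

(* If the k-th and (k+1)-st singular values differ, all SVDs of A give the same truncation.
   In case of a positive tie the truncation depends on the SVD and one of them is chosen. *)
definition best_rank_approx :: "nat \<Rightarrow> real mat \<Rightarrow> real mat" where
  "best_rank_approx k A =
     (SOME B. \<exists>U S V. is_svd A U S V \<and> B = U * truncate_diag k S * transpose_mat V)"

end

theory Submission
  imports Defs "HOL-Analysis.Function_Topology"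
begin

text \<open>
  Write \<open>A = U S V\<^sup>T\<close> and \<open>A + E = U' S' V'\<^sup>T\<close> with singular values \<open>s\<close> and \<open>s'\<close>, and put
  \<open>W = U'\<^sup>T U\<close>, \<open>Z = V'\<^sup>T V\<close>. Then \<open>F = U'\<^sup>T E V\<close> and \<open>G = V'\<^sup>T E\<^sup>T U\<close> have the Frobenius norm of \<open>E\<close>
  and the entries \<open>F i j = s' i * Z i j - s j * W i j\<close> and \<open>G i j = s' i * W i j - s j * Z i j\<close>.
  Truncation replaces \<open>s\<close>, \<open>s'\<close> by zero from index \<open>k\<close> on, so the transformed difference of the
  truncations has the entries \<open>F i j\<close>, \<open>s' i * Z i j\<close>, \<open>- s j * W i j\<close> and \<open>0\<close> on its four blocks. On the
  two mixed blocks one of \<open>s' i\<close>, \<open>s j\<close> is at most half the other, by the gap and a Weyl inequality,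
  and solving the two linear equations bounds the entry by \<open>F i j\<close> and \<open>G i j\<close>. This gives the
  stronger bound \<open>3 * frobenius_norm E\<close>. The Weyl inequality follows from the same entrywise
  identities. Singular value decompositions are obtained by maximising a weighted trace of
  \<open>U\<^sup>T A V\<close> with strictly decreasing weights over all orthogonal \<open>U\<close>, \<open>V\<close>: stationarity under
  plane rotations kills the off-diagonal entries.
\<close>

section \<open>Orthogonal matrices\<close>

definition orth_mat :: "nat \<Rightarrow> real mat \<Rightarrow> bool" where
  "orth_mat n U \<longleftrightarrow> U \<in> carrier_mat n n \<and> transpose_mat U * U = 1\<^sub>m n"

lemma orth_mat_carrier: "orth_mat n U \<Longrightarrow> U \<in> carrier_mat n n"
  by (simp add: orth_mat_def)

lemma orth_mat_right_inverse:
  assumes "orth_mat n U"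
  shows "U * transpose_mat U = 1\<^sub>m n"
  using assms mat_mult_left_right_inverse[of "transpose_mat U" n U]
  by (simp add: orth_mat_def)

lemma orth_mat_transpose: "orth_mat n U \<Longrightarrow> orth_mat n (transpose_mat U)"
  using orth_mat_right_inverse by (simp add: orth_mat_def)

lemma orth_mat_one: "orth_mat n (1\<^sub>m n)"
  by (simp add: orth_mat_def)

lemma orth_mat_mult:
  assumes "orth_mat n U" "orth_mat n V"
  shows "orth_mat n (U * V)"
proof -
  have U: "U \<in> carrier_mat n n" and V: "V \<in> carrier_mat n n"
    using assms by (auto simp: orth_mat_def)
  have "transpose_mat (U * V) * (U * V) = transpose_mat V * ((transpose_mat U * U) * V)"
    using U V by (simp add: transpose_mult[OF U V] assoc_mult_mat[of _ n n _ n _ n])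
  also have "\<dots> = 1\<^sub>m n"
    using assms U V by (simp add: orth_mat_def)
  finally show ?thesis using U V by (simp add: orth_mat_def)
qed

lemma orth_mat_cancel_left:
  assumes "orth_mat m U" "M \<in> carrier_mat m n"
  shows "transpose_mat U * (U * M) = M" "U * (transpose_mat U * M) = M"
proof -
  have U: "U \<in> carrier_mat m m" using assms by (auto simp: orth_mat_def)
  show "transpose_mat U * (U * M) = M"
    using U assms by (simp add: assoc_mult_mat[of _ m m _ m _ n, symmetric] orth_mat_def)
  show "U * (transpose_mat U * M) = M"
    using U assms orth_mat_right_inverse[OF assms(1)]
    by (simp add: assoc_mult_mat[of _ m m _ m _ n, symmetric])
qed

text \<open>Entries of products are to be expanded into the sums of \<open>index_mult_sum\<close>,
  not into scalar products of rows and columns.\<close>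

declare index_mult_mat(1) [simp del]

lemma index_mult_sum:
  assumes "A \<in> carrier_mat m p" "B \<in> carrier_mat p n" "i < m" "j < n"
  shows "(A * B) $$ (i,j) = (\<Sum>l<p. A $$ (i,l) * B $$ (l,j))"
  using assms by (auto simp: index_mult_mat(1) scalar_prod_def atLeast0LessThan intro!: sum.cong)

text \<open>Finitely many polynomial equations in the entries; in this form orthogonality is visibly
  a closed condition.\<close>

lemma orth_mat_iff:
  "orth_mat n U \<longleftrightarrow> U \<in> carrier_mat n n \<and>
    (\<forall>i<n. \<forall>j<n. (\<Sum>l<n. U $$ (l,i) * U $$ (l,j)) = (if i = j then 1 else 0))"
proof (cases "U \<in> carrier_mat n n")
  case True
  have "(transpose_mat U * U) $$ (i,j) = (\<Sum>l<n. U $$ (l,i) * U $$ (l,j))" if "i < n" "j < n" for i j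
    using that True by (simp add: index_mult_sum[of _ n n _ n])
  moreover have "transpose_mat U * U = 1\<^sub>m n \<longleftrightarrow>
      (\<forall>i<n. \<forall>j<n. (transpose_mat U * U) $$ (i,j) = 1\<^sub>m n $$ (i,j))"
    using True by (auto simp: mat_eq_iff)
  ultimately show ?thesis using True by (simp add: orth_mat_def)
qed (simp add: orth_mat_def)

lemma orth_mat_col_sum:
  "orth_mat n U \<Longrightarrow> j < n \<Longrightarrow> (\<Sum>i<n. (U $$ (i,j))\<^sup>2) = 1"
  by (auto simp: orth_mat_iff power2_eq_square)

lemma orth_mat_entry_bound:
  assumes "orth_mat n U" "i < n" "j < n"
  shows "\<bar>U $$ (i,j)\<bar> \<le> 1"
proof -
  have "(U $$ (i,j))\<^sup>2 \<le> (\<Sum>i<n. (U $$ (i,j))\<^sup>2)"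
    using assms by (intro member_le_sum) auto
  then show ?thesis using orth_mat_col_sum[OF assms(1,3)] by (simp add: abs_square_le_1)
qed

section \<open>Existence of singular value decompositions\<close>

text \<open>With p the smaller dimension, the weights are p, p - 1, ..., 1. At a maximiser their
  positivity yields a nonnegative diagonal, their strict decrease a sorted one, and both together
  the vanishing of the off-diagonal entries.\<close>

definition weighted_trace :: "real mat \<Rightarrow> real" where
  "weighted_trace M =
    (\<Sum>i<min (dim_row M) (dim_col M). real (min (dim_row M) (dim_col M) - i) * M $$ (i,i))"

lemma weighted_trace_transpose: "weighted_trace (transpose_mat M) = weighted_trace M"
  by (auto simp: weighted_trace_def min.commute intro!: sum.cong)

section \<open>Compactness and the maximiser\<close>

text \<open>Tychonoff: the cube is a product of copies of the interval from -1 to 1, and the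
  function type carries the product topology.\<close>

lemma compact_unit_cube: "compact {u :: 'a \<Rightarrow> real. \<forall>p. \<bar>u p\<bar> \<le> 1}"
proof -
  have "compactin (product_topology (\<lambda>_. euclidean) UNIV) (PiE UNIV (\<lambda>_::'a. {-1..1::real}))"
    by (simp add: compactin_PiE)
  moreover have "-1 \<le> x \<and> x \<le> 1 \<longleftrightarrow> \<bar>x\<bar> \<le> 1" for x :: real
    by linarith
  then have "PiE UNIV (\<lambda>_::'a. {-1..1::real}) = {u. \<forall>p. \<bar>u p\<bar> \<le> 1}"
    by (simp add: PiE_UNIV_domain Pi_def)
  ultimately show ?thesis
    by (simp add: euclidean_product_topology)
qed

text \<open>A closed subset of the cube. The bound is imposed at every index pair because
  orthogonality does not restrict the values outside the n by n square.\<close>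

lemma compact_orth_functions:
  "compact {u :: nat \<times> nat \<Rightarrow> real. (\<forall>p. \<bar>u p\<bar> \<le> 1) \<and> orth_mat n (mat n n u)}"
proof -
  have cl: "closed {u :: nat \<times> nat \<Rightarrow> real. (\<Sum>l<n. u (l,i) * u (l,j)) = c}" for i j c
    by (intro closed_Collect_eq continuous_on_sum continuous_on_mult continuous_on_const
        continuous_on_product_coordinates)
  have cl': "closed (\<Inter>i\<in>{..<n}. \<Inter>j\<in>{..<n}.
      {u :: nat \<times> nat \<Rightarrow> real. (\<Sum>l<n. u (l,i) * u (l,j)) = (if i = j then 1 else 0)})"
    by (rule closed_INT, rule ballI, rule closed_INT, rule ballI, rule cl)
  have eq: "{u :: nat \<times> nat \<Rightarrow> real. (\<forall>p. \<bar>u p\<bar> \<le> 1) \<and> orth_mat n (mat n n u)} =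
    {u. \<forall>p. \<bar>u p\<bar> \<le> 1} \<inter> (\<Inter>i\<in>{..<n}. \<Inter>j\<in>{..<n}.
      {u. (\<Sum>l<n. u (l,i) * u (l,j)) = (if i = j then 1 else 0)})"
    by (auto simp: orth_mat_iff)
  show ?thesis
    unfolding eq by (rule compact_Int_closed[OF compact_unit_cube cl'])
qed

text \<open>Extreme value theorem on a product of two compact sets. Matrices are represented by
  functions on index pairs, on which the trace is the polynomial \<open>f\<close>.\<close>

lemma weighted_trace_maximizer:
  assumes A: "A \<in> carrier_mat m n"
  obtains U V where "orth_mat m U" "orth_mat n V"
    "\<And>U' V'. orth_mat m U' \<Longrightarrow> orth_mat n V' \<Longrightarrow>
      weighted_trace (transpose_mat U' * A * V') \<le> weighted_trace (transpose_mat U * A * V)"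
proof -
  define K where "K N = {u :: nat \<times> nat \<Rightarrow> real. (\<forall>p. \<bar>u p\<bar> \<le> 1) \<and> orth_mat N (mat N N u)}" for N
  define f where "f = (\<lambda>(u,v). \<Sum>i<min m n. real (min m n - i) *
    (\<Sum>l<m. u (l,i) * (\<Sum>p<n. A $$ (l,p) * v (p,i))))"
  have f: "weighted_trace (transpose_mat U * A * V) = f (($$) U, ($$) V)"
    if "U \<in> carrier_mat m m" "V \<in> carrier_mat n n" for U V
    using that A by (simp add: weighted_trace_def f_def index_mult_sum[of _ m n _ n]
        index_mult_sum[of _ m m _ n])
  have f_cong: "f (u,v) = f (u',v')"
    if "\<forall>l<m. \<forall>i<m. u (l,i) = u' (l,i)" "\<forall>l<n. \<forall>i<n. v (l,i) = v' (l,i)" for u v u' v'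
    using that by (simp add: f_def)
  \<comment> \<open>Out of range, \<open>U $$ (i,j)\<close> need not obey the bound in
    \<open>K N\<close>; extension by zero does, and \<open>f\<close> does not see the
    change.\<close>
  define r where "r N U = (\<lambda>(i,j). if i < N \<and> j < N then U $$ (i,j) else 0 :: real)" for N :: nat and U
  have r: "r N U \<in> K N" "mat N N (r N U) = U" if "orth_mat N U" for N U
  proof -
    show *: "mat N N (r N U) = U"
      using that by (auto simp: r_def orth_mat_def)
    show "r N U \<in> K N"
      unfolding K_def using that * orth_mat_entry_bound[OF that] by (auto simp: r_def)
  qed
  have "compact (K m \<times> K n)"
    unfolding K_def by (intro compact_Times compact_orth_functions)
  moreover have "K m \<times> K n \<noteq> {}"
    using r(1)[OF orth_mat_one] by blast
  moreover have "continuous_on (K m \<times> K n) f"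
    unfolding f_def split_beta
    by (intro continuous_intros continuous_on_compose2[OF continuous_on_product_coordinates continuous_on_fst]
       continuous_on_compose2[OF continuous_on_product_coordinates continuous_on_snd]) auto
  ultimately obtain u v where uv: "u \<in> K m" "v \<in> K n"
    and max: "\<And>u' v'. u' \<in> K m \<Longrightarrow> v' \<in> K n \<Longrightarrow> f (u',v') \<le> f (u,v)"
    using continuous_attains_sup[of "K m \<times> K n" f] by blast
  show thesis
  proof
    show "orth_mat m (mat m m u)" "orth_mat n (mat n n v)" using uv by (auto simp: K_def)
    fix U' V' assume *: "orth_mat m U'" "orth_mat n V'"
    have "weighted_trace (transpose_mat U' * A * V') = f (($$) U', ($$) V')"
      using * by (intro f) (auto simp: orth_mat_def)
    also have "\<dots> = f (r m U', r n V')" by (intro f_cong) (auto simp: r_def)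
    also have "\<dots> \<le> f (u,v)" using * by (intro max r)
    also have "\<dots> = f (($$) (mat m m u), ($$) (mat n n v))" by (intro f_cong) auto
    also have "\<dots> = weighted_trace (transpose_mat (mat m m u) * A * mat n n v)"
      by (intro f[symmetric]) auto
    finally show "weighted_trace (transpose_mat U' * A * V')
      \<le> weighted_trace (transpose_mat (mat m m u) * A * mat n n v)" .
  qed
qed

section \<open>Plane rotations and stationarity\<close>

text \<open>A Givens rotation in the plane of coordinates \<open>i\<close> and \<open>j\<close>,
  with x and y in the place of cosine and sine.\<close>

definition rotation_mat :: "nat \<Rightarrow> nat \<Rightarrow> nat \<Rightarrow> real \<Rightarrow> real \<Rightarrow> real mat" where
  "rotation_mat n i j x y = mat n n (\<lambda>(a,b).
     if a = i then (if b = i then x else if b = j then y else 0)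
     else if a = j then (if b = i then - y else if b = j then x else 0)
     else if a = b then 1 else 0)"

lemma index_rotation_mat_mult:
  assumes "M \<in> carrier_mat m n" "i < m" "j < m" "i \<noteq> j" "a < m" "b < n"
  shows "(rotation_mat m i j x y * M) $$ (a,b) =
    (if a = i then x * M $$ (i,b) + y * M $$ (j,b)
     else if a = j then x * M $$ (j,b) - y * M $$ (i,b) else M $$ (a,b))"
proof -
  have R: "rotation_mat m i j x y \<in> carrier_mat m m" by (simp add: rotation_mat_def)
  have "(rotation_mat m i j x y * M) $$ (a,b) = (\<Sum>l<m. rotation_mat m i j x y $$ (a,l) * M $$ (l,b))"
    using assms by (intro index_mult_sum[OF R])
  also have "\<dots> = (\<Sum>l<m.
     if a = i then (if l = i then x * M $$ (i,b) else 0) + (if l = j then y * M $$ (j,b) else 0)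
     else if a = j then (if l = i then - y * M $$ (i,b) else 0) + (if l = j then x * M $$ (j,b) else 0)
     else (if l = a then M $$ (a,b) else 0))"
    using assms by (intro sum.cong) (auto simp: rotation_mat_def)
  also have "\<dots> = (if a = i then x * M $$ (i,b) + y * M $$ (j,b)
     else if a = j then x * M $$ (j,b) - y * M $$ (i,b) else M $$ (a,b))"
    using assms by (simp add: sum.distrib)
  finally show ?thesis .
qed

lemma orth_rotation_mat:
  assumes "x\<^sup>2 + y\<^sup>2 = 1" "i < n" "j < n" "i \<noteq> j"
  shows "orth_mat n (rotation_mat n i j x y)"
proof -
  have R: "rotation_mat n i j x y \<in> carrier_mat n n" by (simp add: rotation_mat_def)
  \<comment> \<open>\<open>index_rotation_mat_mult\<close> computes left multiplication by a
    rotation, so this order of the factors is checked and the other one follows by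
    transposition.\<close>
  have "rotation_mat n i j x y * transpose_mat (rotation_mat n i j x y) = 1\<^sub>m n"
  proof (rule eq_matI)
    fix a b assume "a < dim_row (1\<^sub>m n :: real mat)" "b < dim_col (1\<^sub>m n :: real mat)"
    then show "(rotation_mat n i j x y * transpose_mat (rotation_mat n i j x y)) $$ (a, b) = 1\<^sub>m n $$ (a, b)"
      using assms R by (subst index_rotation_mat_mult[of _ n n])
        (auto simp: rotation_mat_def power2_eq_square algebra_simps)
  qed (auto simp: rotation_mat_def)
  then have "orth_mat n (transpose_mat (rotation_mat n i j x y))"
    using R by (simp add: orth_mat_def)
  from orth_mat_transpose[OF this] show ?thesis by simp
qed

text \<open>On the unit circle the linear form attains the length r of (\<alpha>, \<beta>), at
  (\<alpha>/r, \<beta>/r). If \<alpha> is an upper bound, then r \<le> \<alpha>, which forces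
  \<beta> = 0.\<close>

lemma stationary_imp_zero:
  fixes \<alpha> \<beta> :: real
  assumes "\<And>x y. x\<^sup>2 + y\<^sup>2 = 1 \<Longrightarrow> x * \<alpha> + y * \<beta> \<le> \<alpha>"
  shows "\<beta> = 0"
proof (rule ccontr)
  assume "\<beta> \<noteq> 0"
  define r where "r = sqrt (\<alpha>\<^sup>2 + \<beta>\<^sup>2)"
  have r2: "r\<^sup>2 = \<alpha>\<^sup>2 + \<beta>\<^sup>2" and r: "r > 0"
    using \<open>\<beta> \<noteq> 0\<close> by (auto simp: r_def sum_power2_gt_zero_iff)
  have "(\<alpha>/r)\<^sup>2 + (\<beta>/r)\<^sup>2 = 1"
    using \<open>\<beta> \<noteq> 0\<close> r2 by (simp add: power_divide flip: add_divide_distrib)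
  from assms[OF this] have "r\<^sup>2 / r \<le> \<alpha>"
    by (simp add: r2) (simp add: power2_eq_square add_divide_distrib)
  then have "r \<le> \<alpha>" using r by (simp add: power2_eq_square)
  then have "r\<^sup>2 \<le> \<alpha>\<^sup>2" using r by (intro power_mono) auto
  then show False using r2 \<open>\<beta> \<noteq> 0\<close> by simp
qed

text \<open>Rotating rows \<open>i\<close> and \<open>j\<close> turns their share of the trace into
  a linear form in (x, y) whose y-coefficient is the difference of the two sides; stationarity makes
  it vanish.\<close>

lemma weighted_trace_max_offdiag:
  assumes M: "M \<in> carrier_mat m n"
    and max: "\<And>R. orth_mat m R \<Longrightarrow> weighted_trace (R * M) \<le> weighted_trace M"
    and ij: "i < min m n" "j < m" "i \<noteq> j"
  shows "real (min m n - i) * M $$ (j,i) = real (min m n - j) * M $$ (i,j)"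
proof -
  define c where "c a = real (min m n - a)" for a
  have "x * (c i * M $$ (i,i) + c j * M $$ (j,j)) + y * (c i * M $$ (j,i) - c j * M $$ (i,j))
      \<le> c i * M $$ (i,i) + c j * M $$ (j,j)" if "x\<^sup>2 + y\<^sup>2 = 1" for x y
  proof -
    let ?R = "rotation_mat m i j x y"
    have dim: "dim_row (?R * M) = m" "dim_col (?R * M) = n" using M by (auto simp: rotation_mat_def)
    have "weighted_trace (?R * M) - weighted_trace M =
        (\<Sum>a<min m n. c a * ((?R * M) $$ (a,a) - M $$ (a,a)))"
      unfolding weighted_trace_def dim c_def using M
      by (simp add: right_diff_distrib flip: sum_subtractf)
    also have "\<dots> = (\<Sum>a<min m n.
        (if a = i then c i * ((x - 1) * M $$ (i,i) + y * M $$ (j,i)) else 0) +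
        (if a = j then c j * ((x - 1) * M $$ (j,j) - y * M $$ (i,j)) else 0))"
      using ij by (intro sum.cong) (auto simp: index_rotation_mat_mult[OF M] algebra_simps)
    also have "\<dots> = c i * ((x - 1) * M $$ (i,i) + y * M $$ (j,i)) +
        c j * ((x - 1) * M $$ (j,j) - y * M $$ (i,j))"
      \<comment> \<open>If \<open>j\<close> is at least \<open>min m n\<close>, the sum has no term
        at \<open>j\<close>, and truncated subtraction makes \<open>c j\<close> zero, so the formula
        still holds.\<close>
      using ij by (simp add: sum.distrib) (auto simp: c_def)
    finally show ?thesis
      using max[OF orth_rotation_mat[OF that, of i m j]] ij by (simp add: algebra_simps)
  qed
  from stationary_imp_zero[OF this] show ?thesis by (simp add: c_def)
qed

text \<open>Changing the sign of row \<open>i\<close> changes the trace by -2 times a positive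
  weight times \<open>M $$ (i,i)\<close>, which maximality makes nonpositive.\<close>

lemma weighted_trace_max_diag_nonneg:
  assumes M: "M \<in> carrier_mat m n"
    and max: "\<And>R. orth_mat m R \<Longrightarrow> weighted_trace (R * M) \<le> weighted_trace M"
    and i: "i < min m n"
  shows "0 \<le> M $$ (i,i)"
proof -
  define R where "R = mat_diag m (\<lambda>a. if a = i then - 1 else 1 :: real)"
  have RM: "R * M = Matrix.mat m n (\<lambda>(a,b). (if a = i then - 1 else 1) * M $$ (a,b))"
    unfolding R_def using mat_diag_mult_left[OF M] .
  have "transpose_mat R = R" by (auto simp: R_def mat_diag_def)
  then have "orth_mat m R"
    by (auto simp: orth_mat_def R_def if_distrib cong: if_cong)
  then have "weighted_trace (R * M) - weighted_trace M \<le> 0" using max by simp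
  moreover have "weighted_trace (R * M) - weighted_trace M =
      (\<Sum>a<min m n. if a = i then - 2 * real (min m n - i) * M $$ (i,i) else 0)"
    unfolding RM weighted_trace_def dim_row_mat dim_col_mat carrier_matD[OF M] sum_subtractf[symmetric]
    by (intro sum.cong) (auto simp: algebra_simps)
  ultimately show ?thesis using i by (auto simp: mult_le_0_iff zero_le_mult_iff)
qed

text \<open>Quarter turns on both sides exchange the diagonal entries at \<open>i\<close> and
  \<open>j\<close>, the two signs cancelling. The trace changes by (j - i) times the difference of
  these entries.\<close>

lemma weighted_trace_max_sorted:
  assumes M: "M \<in> carrier_mat m n"
    and max: "\<And>R T. orth_mat m R \<Longrightarrow> orth_mat n T \<Longrightarrow> weighted_trace (R * M * T) \<le> weighted_trace M"
    and ij: "i < j" "j < min m n"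
  shows "M $$ (j,j) \<le> M $$ (i,i)"
proof -
  let ?R = "rotation_mat m i j 0 1" and ?T = "rotation_mat n i j 0 1"
  have R: "orth_mat m ?R" and T: "orth_mat n ?T"
    using ij by (auto intro!: orth_rotation_mat)
  have RM: "?R * M \<in> carrier_mat m n" using M by (auto simp: rotation_mat_def)
  \<comment> \<open>Right multiplication is turned into left multiplication of the transpose, so
    that \<open>index_rotation_mat_mult\<close> applies to both factors.\<close>
  have eq: "?R * M * transpose_mat ?T = transpose_mat (?T * transpose_mat (?R * M))"
    using transpose_mult[of ?T n n "transpose_mat (?R * M)" m] RM orth_mat_carrier[OF T] by simp
  have diag: "(?R * M * transpose_mat ?T) $$ (a,a) =
      (if a = i then M $$ (j,j) else if a = j then M $$ (i,i) else M $$ (a,a))" if "a < min m n" for a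
  proof -
    have "(?R * M * transpose_mat ?T) $$ (a,a) = (?T * transpose_mat (?R * M)) $$ (a,a)"
      unfolding eq using that RM orth_mat_carrier[OF T]
      by (subst index_transpose_mat) (simp_all add: rotation_mat_def)
    also have "\<dots> = (if a = i then (?R * M) $$ (a,j) else if a = j then - (?R * M) $$ (a,i) else (?R * M) $$ (a,a))"
      using index_rotation_mat_mult[of "transpose_mat (?R * M)" n m i j a a 0 1] that ij RM
      by (simp del: index_mult_mat)
    also have "\<dots> = (if a = i then M $$ (j,j) else if a = j then M $$ (i,i) else M $$ (a,a))"
      using that ij by (auto simp: index_rotation_mat_mult[OF M])
    finally show ?thesis .
  qed
  have dim: "dim_row (?R * M * transpose_mat ?T) = m" "dim_col (?R * M * transpose_mat ?T) = n"
    using M by (auto simp: rotation_mat_def)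
  have "weighted_trace (?R * M * transpose_mat ?T) - weighted_trace M =
    (\<Sum>a<min m n. real (min m n - a) * ((?R * M * transpose_mat ?T) $$ (a,a) - M $$ (a,a)))"
    unfolding weighted_trace_def dim using M
    by (simp add: right_diff_distrib flip: sum_subtractf)
  also have "\<dots> = (\<Sum>a<min m n.
      (if a = i then real (min m n - i) * (M $$ (j,j) - M $$ (i,i)) else 0) +
      (if a = j then real (min m n - j) * (M $$ (i,i) - M $$ (j,j)) else 0))"
    using ij by (intro sum.cong) (auto simp: diag algebra_simps)
  also have "\<dots> = (real (min m n - i) - real (min m n - j)) * (M $$ (j,j) - M $$ (i,i))"
    using ij by (simp add: sum.distrib) (simp add: algebra_simps)
  also have "real (min m n - i) - real (min m n - j) = real (j - i)"
    using ij by (auto simp: of_nat_diff)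
  finally have "real (j - i) * (M $$ (j,j) - M $$ (i,i)) \<le> 0"
    using max[OF R orth_mat_transpose[OF T]] by simp
  then show ?thesis using ij by (auto simp: mult_le_0_iff)
qed

lemma svd_exists: "\<exists>U S V. is_svd A U S V"
proof -
  define m n where "m = dim_row A" and "n = dim_col A"
  have A: "A \<in> carrier_mat m n" by (simp add: m_def n_def)
  obtain U V where U: "orth_mat m U" and V: "orth_mat n V"
    and max: "\<And>U' V'. orth_mat m U' \<Longrightarrow> orth_mat n V' \<Longrightarrow>
      weighted_trace (transpose_mat U' * A * V') \<le> weighted_trace (transpose_mat U * A * V)"
    using weighted_trace_maximizer[OF A] by metis
  note carr = A orth_mat_carrier[OF U] orth_mat_carrier[OF V]
  define M where "M = transpose_mat U * A * V"
  have M: "M \<in> carrier_mat m n" using carr by (auto simp: M_def)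
  have A_eq: "A = U * M * transpose_mat V"
  proof -
    have "U * M * transpose_mat V = U * (transpose_mat U * (A * V)) * transpose_mat V"
      using carr by (simp add: M_def)
    also have "\<dots> = A"
      using carr by (simp add: orth_mat_cancel_left[OF U, of _ n] orth_mat_right_inverse[OF V])
    finally show ?thesis by simp
  qed
  \<comment> \<open>Passing from \<open>M\<close> to \<open>R * M * T\<close> amounts to replacing
    \<open>U\<close> by \<open>U * transpose_mat R\<close> and \<open>V\<close> by
    \<open>V * T\<close>, which are again orthogonal.\<close>
  have maxM: "weighted_trace (R * M * T) \<le> weighted_trace M"
    if R: "orth_mat m R" and T: "orth_mat n T" for R T
  proof -
    note carr' = carr orth_mat_carrier[OF R] orth_mat_carrier[OF T]
    have "R * M * T = transpose_mat (U * transpose_mat R) * A * (V * T)"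
      using carr' by (simp add: M_def transpose_mult[of _ m m] assoc_mult_mat[of _ m n _ n _ n]
         assoc_mult_mat[of _ m m _ n _ n] assoc_mult_mat[of _ m m _ m _ n])
    then show ?thesis
      using max[OF orth_mat_mult[OF U orth_mat_transpose[OF R]] orth_mat_mult[OF V T]] by (simp add: M_def)
  qed
  have maxL: "weighted_trace (R * M) \<le> weighted_trace M" if "orth_mat m R" for R
    using maxM[OF that orth_mat_one] M orth_mat_carrier[OF that] by simp
  have maxR: "weighted_trace (R * transpose_mat M) \<le> weighted_trace (transpose_mat M)"
    if "orth_mat n R" for R
  proof -
    have "R * transpose_mat M = transpose_mat (M * transpose_mat R)"
      using M orth_mat_carrier[OF that] by (simp add: transpose_mult[of _ m n])
    then show ?thesis
      using maxM[OF orth_mat_one orth_mat_transpose[OF that]] M by (simp add: weighted_trace_transpose)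
  qed
  have left: "real (min m n - i) * M $$ (j,i) = real (min m n - j) * M $$ (i,j)"
    if "i < min m n" "j < m" "i \<noteq> j" for i j
    using weighted_trace_max_offdiag[OF M maxL that] .
  have right: "real (min m n - i) * M $$ (i,j) = real (min m n - j) * transpose_mat M $$ (i,j)"
    if "i < min m n" "j < n" "i \<noteq> j" for i j
    using weighted_trace_max_offdiag[of "transpose_mat M" n m i j] maxR that M
    by (simp add: min.commute)
  have offdiag: "M $$ (i,j) = 0" if "i < m" "j < n" "i \<noteq> j" for i j
  proof -
    consider "i < min m n" "j < min m n" | "j < min m n" "min m n \<le> i" | "i < min m n" "min m n \<le> j"
      using \<open>i < m\<close> \<open>j < n\<close> by linarith
    then show ?thesis
    proof cases
      case 1
      define a b where "a = real (min m n - i)" and "b = real (min m n - j)"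
      have "a * M $$ (j,i) = b * M $$ (i,j)" "a * M $$ (i,j) = b * M $$ (j,i)"
        using left[of i j] right[of i j] 1 that M by (auto simp: a_def b_def)
      \<comment> \<open>Row and column rotations give the same relation with the weights exchanged;
        eliminating \<open>M $$ (j,i)\<close> leaves this equation.\<close>
      then have "(a\<^sup>2 - b\<^sup>2) * M $$ (i,j) = 0" by (simp add: power2_eq_square algebra_simps)
      moreover have "a > 0" "b > 0" "a \<noteq> b" using 1 \<open>i \<noteq> j\<close> by (auto simp: a_def b_def)
      then have "a\<^sup>2 - b\<^sup>2 \<noteq> 0" by (simp add: power2_eq_iff)
      ultimately show ?thesis by simp
    next
      case 2
      \<comment> \<open>The index beyond the diagonal has weight 0, so the relation says that a
        positive weight times \<open>M $$ (i,j)\<close> vanishes.\<close>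
      then show ?thesis using left[of j i] that by auto
    next
      case 3
      then show ?thesis using right[of i j] that by auto
    qed
  qed
  have "is_svd A U M V"
    unfolding is_svd_def m_def[symmetric] n_def[symmetric]
  proof (intro conjI allI impI)
    show "diagonal_mat M" unfolding diagonal_mat_def using offdiag M by auto
    show "0 \<le> M $$ (i,i)" if "i < min m n" for i
      using weighted_trace_max_diag_nonneg[OF M maxL that] .
    show "M $$ (j,j) \<le> M $$ (i,i)" if "i \<le> j \<and> j < min m n" for i j
      using weighted_trace_max_sorted[OF M maxM, of i j] that by (cases "i = j") auto
  qed (use U V M A_eq in \<open>auto simp: orth_mat_def\<close>)
  then show ?thesis by blast
qed

section \<open>Singular values and the Frobenius norm\<close>

text \<open>Zero padding lets the entrywise identities for rectangular diagonal factors hold at all indices.\<close>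

definition entry :: "real mat \<Rightarrow> nat \<Rightarrow> nat \<Rightarrow> real" where
  "entry M i j = (if i < dim_row M \<and> j < dim_col M then M $$ (i,j) else 0)"

lemma entry_transpose: "entry (transpose_mat M) i j = entry M j i"
  by (auto simp: entry_def)

lemma entry_minus:
  "A \<in> carrier_mat m n \<Longrightarrow> B \<in> carrier_mat m n \<Longrightarrow> entry (A - B) i j = entry A i j - entry B i j"
  by (auto simp: entry_def)

lemma entry_diagonal: "diagonal_mat S \<Longrightarrow> i \<noteq> j \<Longrightarrow> entry S i j = 0"
  by (auto simp: entry_def diagonal_mat_def)

lemma entry_mult:
  assumes "A \<in> carrier_mat m p" "B \<in> carrier_mat p n"
  shows "entry (A * B) i j = (\<Sum>l<p. entry A i l * entry B l j)"
  using assms by (auto simp: entry_def index_mult_sum[of _ m p _ n])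

lemma entry_diagonal_mult:
  assumes S: "S \<in> carrier_mat m n" "diagonal_mat S" and Z: "Z \<in> carrier_mat n p"
  shows "entry (S * Z) i j = entry S i i * entry Z i j"
proof -
  have "entry (S * Z) i j = (\<Sum>l<n. if l = i then entry S i i * entry Z i j else 0)"
    unfolding entry_mult[OF S(1) Z] using S by (intro sum.cong) (auto simp: entry_diagonal)
  then show ?thesis using S by (auto simp: entry_def)
qed

lemma diagonal_mat_transpose: "diagonal_mat S \<Longrightarrow> diagonal_mat (transpose_mat S)"
  by (auto simp: diagonal_mat_def)

lemma entry_mult_diagonal:
  assumes W: "W \<in> carrier_mat p m" and S: "S \<in> carrier_mat m n" "diagonal_mat S"
  shows "entry (W * S) i j = entry W i j * entry S j j"
proof -
  have "entry (W * S) i j = entry (transpose_mat S * transpose_mat W) j i"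
    using W S by (simp add: entry_transpose flip: transpose_mult[OF W S(1)])
  also have "\<dots> = entry W i j * entry S j j"
    using W S by (subst entry_diagonal_mult[of _ n m _ p]) (auto simp: entry_transpose diagonal_mat_transpose)
  finally show ?thesis .
qed

section \<open>Singular values read off a decomposition\<close>

text \<open>The padded diagonal is zero past the smaller dimension, so nonnegativity and
  monotonicity extend to all indices.\<close>

lemma is_svdD:
  assumes "is_svd A U S V" "A \<in> carrier_mat m n"
  shows "orth_mat m U" "orth_mat n V" "S \<in> carrier_mat m n" "diagonal_mat S"
    "A = U * S * transpose_mat V"
    "\<And>i. 0 \<le> entry S i i" "\<And>i j. i \<le> j \<Longrightarrow> entry S j j \<le> entry S i i"
  using assms by (auto simp: is_svd_def orth_mat_def entry_def)

text \<open>The Gram matrix is similar to \<open>transpose_mat S * S\<close>, a diagonal matrix with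
  the squared diagonal of \<open>S\<close>. Its characteristic polynomial splits accordingly, and
  the square roots are already in decreasing order.\<close>

lemma singular_values_svd:
  assumes svd: "is_svd A U S V" and A: "A \<in> carrier_mat m n"
  shows "singular_values A = map (\<lambda>i. entry S i i) [0..<n]"
proof -
  note S = is_svdD[OF assms]
  note carr = orth_mat_carrier[OF S(1)] orth_mat_carrier[OF S(2)] S(3)
  define D where "D = transpose_mat S * S"
  have D: "D \<in> carrier_mat n n" using S by (simp add: D_def)
  have D_entry: "D $$ (i,j) = (if i = j then (entry S i i)\<^sup>2 else 0)" if "i < n" "j < n" for i j
  proof -
    have "D $$ (i,j) = entry D i j" using that D by (simp add: entry_def)
    also have "\<dots> = entry S i i * entry S i j"
      unfolding D_def using S by (subst entry_diagonal_mult[of _ n m _ n])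
        (auto simp: entry_transpose diagonal_mat_transpose)
    finally show ?thesis using S by (auto simp: entry_diagonal power2_eq_square)
  qed
  have "transpose_mat A * A = V * (transpose_mat S * (transpose_mat U * (U * (S * transpose_mat V))))"
    unfolding S(5) using carr by (simp add: transpose_mult[of _ m n _ n] transpose_mult[of _ m m _ n]
        assoc_mult_mat[of _ n n _ m _ n] assoc_mult_mat[of _ n m _ m _ n])
  also have "\<dots> = V * D * transpose_mat V"
    using carr by (simp add: orth_mat_cancel_left[OF S(1), of _ n] D_def
        assoc_mult_mat[of _ n n _ n _ n] assoc_mult_mat[of _ n m _ n _ n])
  finally have "similar_mat (transpose_mat A * A) D"
    using A D carr S orth_mat_right_inverse[OF S(2)]
    by (intro similar_matI[of _ _ V "transpose_mat V" n]) (auto simp: orth_mat_def)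
  then have "char_poly (transpose_mat A * A) = char_poly D" by (rule char_poly_similar)
  also have "\<dots> = (\<Prod>a\<leftarrow>diag_mat D. [:- a, 1:])"
    using D D_entry by (intro char_poly_upper_triangular) auto
  also have "diag_mat D = map (\<lambda>i. (entry S i i)\<^sup>2) [0..<n]"
    using D D_entry by (auto simp: diag_mat_def)
  finally have char_poly: "char_poly (transpose_mat A * A) =
    (\<Prod>a\<leftarrow>map (\<lambda>i. (entry S i i)\<^sup>2) [0..<n]. [:- a, 1:])" .
  have proots: "proots (\<Prod>a\<leftarrow>xs. [:- a, 1:]) = mset xs" for xs :: "real list"
  proof (induction xs)
    case (Cons x xs)
    have "(\<Prod>a\<leftarrow>xs. [:- a, 1:]) \<noteq> 0" by (auto simp: prod_list_zero_iff)
    then show ?case using Cons by (simp add: proots_mult del: mult_pCons_left)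
  qed simp
  have "image_mset sqrt (proots (char_poly (transpose_mat A * A))) = mset (map (\<lambda>i. entry S i i) [0..<n])"
    unfolding char_poly proots using S(6) by (simp flip: mset_map add: o_def)
  moreover have "sort (map (\<lambda>i. entry S i i) [0..<n]) = rev (map (\<lambda>i. entry S i i) [0..<n])"
    using S(7) by (intro properties_for_sort) (auto simp: sorted_iff_nth_mono rev_nth)
  ultimately show ?thesis
    by (simp only: singular_values_def sorted_list_of_multiset_mset rev_rev_ident)
qed

lemma singular_value_svd:
  assumes "is_svd A U S V" "A \<in> carrier_mat m n"
  shows "singular_value (i + 1) A = entry S i i"
  using is_svdD(3)[OF assms]
  by (auto simp: singular_value_def singular_values_svd[OF assms] entry_def)

section \<open>Norms\<close>

lemma frobenius_norm_nonneg: "0 \<le> frobenius_norm M"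
  by (simp add: frobenius_norm_def sum_nonneg)

text \<open>Padding to a common square lets matrices of transposed shapes be summed over the same
  index range.\<close>

lemma frobenius_norm_square:
  assumes "dim_row M \<le> N" "dim_col M \<le> N"
  shows "(frobenius_norm M)\<^sup>2 = (\<Sum>i<N. \<Sum>j<N. (entry M i j)\<^sup>2)"
proof -
  have "(\<Sum>i<N. \<Sum>j<N. (entry M i j)\<^sup>2) = (\<Sum>i<dim_row M. \<Sum>j<N. (entry M i j)\<^sup>2)"
    using assms by (intro sum.mono_neutral_right) (auto simp: entry_def)
  also have "\<dots> = (\<Sum>i<dim_row M. \<Sum>j<dim_col M. (M $$ (i,j))\<^sup>2)"
    using assms by (intro sum.cong sum.mono_neutral_cong_right) (auto simp: entry_def)
  finally show ?thesis by (simp add: frobenius_norm_def sum_nonneg)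
qed

lemma frobenius_norm_transpose: "frobenius_norm (transpose_mat M) = frobenius_norm M"
  unfolding frobenius_norm_def by (subst sum.swap) simp

text \<open>\<open>Q * M\<close> and \<open>M\<close> have the same Gram matrix, whose diagonal
  holds the squared column norms.\<close>

lemma frobenius_norm_orth_mult:
  assumes Q: "orth_mat m Q" and M: "M \<in> carrier_mat m n"
  shows "frobenius_norm (Q * M) = frobenius_norm M"
proof -
  have QM: "Q * M \<in> carrier_mat m n" using orth_mat_carrier[OF Q] M by simp
  have gram: "(transpose_mat X * X) $$ (j,j) = (\<Sum>i<m. (X $$ (i,j))\<^sup>2)"
    if "X \<in> carrier_mat m n" "j < n" for X :: "real mat" and j
    using that by (subst index_mult_sum[of _ n m _ n]) (auto simp: power2_eq_square)
  have "transpose_mat (Q * M) * (Q * M) = transpose_mat M * M"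
    using orth_mat_carrier[OF Q] M orth_mat_cancel_left(1)[OF Q M]
    by (simp add: transpose_mult[of _ m m _ n] assoc_mult_mat[of _ n m _ m _ n])
  then have "(\<Sum>i<m. ((Q * M) $$ (i,j))\<^sup>2) = (\<Sum>i<m. (M $$ (i,j))\<^sup>2)" if "j < n" for j
    using gram[OF M that] gram[OF QM that] by simp
  then have "(\<Sum>j<n. \<Sum>i<m. ((Q * M) $$ (i,j))\<^sup>2) = (\<Sum>j<n. \<Sum>i<m. (M $$ (i,j))\<^sup>2)"
    by simp
  moreover have "(\<Sum>i<m. \<Sum>j<n. (X $$ (i,j))\<^sup>2) = (\<Sum>j<n. \<Sum>i<m. (X $$ (i,j))\<^sup>2)" for X :: "real mat"
    by (rule sum.swap)
  ultimately show ?thesis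
    unfolding frobenius_norm_def carrier_matD[OF M] carrier_matD[OF QM] by (simp only:)
qed

lemma frobenius_norm_mult_orth:
  assumes Q: "orth_mat n Q" and M: "M \<in> carrier_mat m n"
  shows "frobenius_norm (M * Q) = frobenius_norm M"
proof -
  have "frobenius_norm (M * Q) = frobenius_norm (transpose_mat Q * transpose_mat M)"
    using orth_mat_carrier[OF Q] M frobenius_norm_transpose[of "M * Q"]
    by (simp add: transpose_mult[of _ m n _ n])
  also have "\<dots> = frobenius_norm M"
    using frobenius_norm_orth_mult[OF orth_mat_transpose[OF Q]] M
    by (simp add: frobenius_norm_transpose)
  finally show ?thesis .
qed

text \<open>A real supremum dominates its members once the set is bounded above. A crude bound by
  absolute row sums supplies this, and the zero vector is the member used.\<close>

lemma op_norm_nonneg: "0 \<le> op_norm A"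
proof -
  let ?X = "{x \<in> carrier_vec (dim_col A). l2_norm_vec x \<le> 1}"
  define C where "C = (\<Sum>i<dim_row A. (\<Sum>j<dim_col A. \<bar>A $$ (i,j)\<bar>)\<^sup>2)"
  have "l2_norm_vec (A *\<^sub>v x) \<le> sqrt C" if x: "x \<in> ?X" for x
  proof -
    have x2: "(\<Sum>j<dim_col A. (x $ j)\<^sup>2) \<le> 1"
      using x by (auto simp: l2_norm_vec_def scalar_prod_def power2_eq_square atLeast0LessThan)
    have x1: "\<bar>x $ j\<bar> \<le> 1" if "j < dim_col A" for j
    proof -
      have "(x $ j)\<^sup>2 \<le> (\<Sum>j<dim_col A. (x $ j)\<^sup>2)" using that by (intro member_le_sum) auto
      also note x2
      finally show ?thesis by (simp add: abs_square_le_1)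
    qed
    have "\<bar>(A *\<^sub>v x) $ i\<bar> \<le> (\<Sum>j<dim_col A. \<bar>A $$ (i,j)\<bar>)" if "i < dim_row A" for i
    proof -
      have "(A *\<^sub>v x) $ i = (\<Sum>j<dim_col A. A $$ (i,j) * x $ j)"
        using that x by (auto simp: scalar_prod_def atLeast0LessThan intro!: sum.cong)
      also have "\<bar>\<dots>\<bar> \<le> (\<Sum>j<dim_col A. \<bar>A $$ (i,j) * x $ j\<bar>)" by (rule sum_abs)
      also have "\<dots> \<le> (\<Sum>j<dim_col A. \<bar>A $$ (i,j)\<bar>)"
        using x1 by (intro sum_mono) (auto simp: abs_mult intro: mult_left_le)
      finally show ?thesis .
    qed
    then have "(\<Sum>i<dim_row A. ((A *\<^sub>v x) $ i)\<^sup>2) \<le> C"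
      unfolding C_def by (intro sum_mono) (auto simp: abs_le_square_iff[symmetric] sum_nonneg)
    then show ?thesis
      by (simp add: l2_norm_vec_def scalar_prod_def power2_eq_square atLeast0LessThan)
  qed
  then have bdd: "bdd_above ((\<lambda>x. l2_norm_vec (A *\<^sub>v x)) ` ?X)" by (intro bdd_aboveI2)
  have "0\<^sub>v (dim_col A) \<in> ?X" by (simp add: l2_norm_vec_def)
  have "0 \<le> l2_norm_vec (A *\<^sub>v 0\<^sub>v (dim_col A))"
    by (simp add: l2_norm_vec_def scalar_prod_def sum_nonneg)
  also have "\<dots> \<le> op_norm A"
    unfolding op_norm_def by (rule cSUP_upper[OF \<open>0\<^sub>v (dim_col A) \<in> ?X\<close> bdd])
  finally show ?thesis .
qed

section \<open>Perturbation bounds\<close>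

text \<open>The right side exceeds the left by 2ab(z - w)^2. With a = \<open>s' i\<close> and b =
  \<open>s j\<close>, this bounds the entries of \<open>Z\<close> and \<open>W\<close> by those of
  \<open>F\<close> and \<open>G\<close>.\<close>

lemma coupled_entry_bound:
  fixes a b z w :: real
  assumes "0 \<le> a" "0 \<le> b"
  shows "(a - b)\<^sup>2 * (z\<^sup>2 + w\<^sup>2) \<le> (a * z - b * w)\<^sup>2 + (a * w - b * z)\<^sup>2"
proof -
  have "(a * z - b * w)\<^sup>2 + (a * w - b * z)\<^sup>2 = (a - b)\<^sup>2 * (z\<^sup>2 + w\<^sup>2) + 2 * (a * b) * (z - w)\<^sup>2"
    by (simp add: power2_eq_square algebra_simps)
  then show ?thesis using assms by simp
qed

text \<open>Here a - b is at least a/2, whence the factor 4.\<close>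

lemma coupled_entry_bound_half:
  fixes a b z w :: real
  assumes "0 \<le> b" "b \<le> a / 2"
  shows "(a * z)\<^sup>2 \<le> 4 * ((a * z - b * w)\<^sup>2 + (a * w - b * z)\<^sup>2)"
proof -
  have "(a * z)\<^sup>2 = 4 * ((a / 2)\<^sup>2 * z\<^sup>2)" by (simp add: power2_eq_square)
  also have "\<dots> \<le> 4 * ((a - b)\<^sup>2 * (z\<^sup>2 + w\<^sup>2))"
    using assms by (intro mult_mono power_mono) auto
  also have "\<dots> \<le> 4 * ((a * z - b * w)\<^sup>2 + (a * w - b * z)\<^sup>2)"
    using coupled_entry_bound[of a b z w] assms by simp
  finally show ?thesis .
qed

text \<open>The first \<open>p + 1\<close> rows carry total mass \<open>p + 1\<close>, and the first \<open>p\<close> columns at most \<open>p\<close>.\<close>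

lemma orth_mat_block_sum_ge_1:
  assumes Q: "orth_mat n Q" and p: "p < n" "n \<le> N"
  shows "1 \<le> (\<Sum>i\<le>p. \<Sum>j\<in>{p..<N}. (entry Q i j)\<^sup>2)"
proof -
  have col: "(\<Sum>i<n. (entry Q i j)\<^sup>2) = 1" if "j < n" "orth_mat n Q" for Q j
    using orth_mat_col_sum[OF that(2,1)] that orth_mat_carrier[OF that(2)] by (simp add: entry_def)
  have row: "(\<Sum>j<n. (entry Q i j)\<^sup>2) = 1" if "i < n" for i
    using col[OF that orth_mat_transpose[OF Q]] by (simp add: entry_transpose)
  have "real p + 1 = (\<Sum>i\<le>p. \<Sum>j<n. (entry Q i j)\<^sup>2)"
    using p by (simp add: row)
  also have "\<dots> = (\<Sum>i\<le>p. \<Sum>j<p. (entry Q i j)\<^sup>2) + (\<Sum>i\<le>p. \<Sum>j\<in>{p..<n}. (entry Q i j)\<^sup>2)"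
    using p by (simp add: lessThan_atLeast0 sum.atLeastLessThan_concat flip: sum.distrib)
  also have "(\<Sum>i\<le>p. \<Sum>j\<in>{p..<n}. (entry Q i j)\<^sup>2) \<le> (\<Sum>i\<le>p. \<Sum>j\<in>{p..<N}. (entry Q i j)\<^sup>2)"
    using p by (intro sum_mono sum_mono2) auto
  also have "(\<Sum>i\<le>p. \<Sum>j<p. (entry Q i j)\<^sup>2) = (\<Sum>j<p. \<Sum>i\<le>p. (entry Q i j)\<^sup>2)"
    by (rule sum.swap)
  also have "\<dots> \<le> (\<Sum>j<p. \<Sum>i<n. (entry Q i j)\<^sup>2)"
    using p by (intro sum_mono sum_mono2) auto
  also have "\<dots> = real p" using p Q by (simp add: col)
  finally show ?thesis by simp
qed

text \<open>On the left \<open>U'\<close> cancels from the first product, on the right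
  \<open>V\<close> from the second. Arbitrary diagonal factors are allowed, so the identity also
  serves for truncations.\<close>

lemma entry_svd_difference:
  assumes U: "orth_mat m U" "orth_mat m U'" and V: "orth_mat n V" "orth_mat n V'"
    and S: "S \<in> carrier_mat m n" "diagonal_mat S" "S' \<in> carrier_mat m n" "diagonal_mat S'"
  shows "entry (transpose_mat U' * (U' * S' * transpose_mat V' - U * S * transpose_mat V) * V) i j =
    entry S' i i * entry (transpose_mat V' * V) i j - entry (transpose_mat U' * U) i j * entry S j j"
proof -
  note carr = orth_mat_carrier[OF U(1)] orth_mat_carrier[OF U(2)]
    orth_mat_carrier[OF V(1)] orth_mat_carrier[OF V(2)] S(1,3)
  have *: "transpose_mat U' * (U' * S' * transpose_mat V') * V = S' * (transpose_mat V' * V)"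
    using carr by (simp add: orth_mat_cancel_left[OF U(2), of _ n])
  have VV: "transpose_mat V * V = 1\<^sub>m n" using V(1) by (simp add: orth_mat_def)
  have **: "transpose_mat U' * (U * S * transpose_mat V) * V = transpose_mat U' * U * S"
    using carr VV by (simp add: assoc_mult_mat[of _ m m _ n _ n] assoc_mult_mat[of _ m n _ n _ n])
  have "transpose_mat U' * (U' * S' * transpose_mat V' - U * S * transpose_mat V) * V =
    transpose_mat U' * (U' * S' * transpose_mat V') * V - transpose_mat U' * (U * S * transpose_mat V) * V"
    using carr by (simp add: mult_minus_distrib_mat[of _ m m _ n] minus_mult_distrib_mat[of _ m n _ _ n])
  also have "entry \<dots> i j = entry (S' * (transpose_mat V' * V)) i j - entry (transpose_mat U' * U * S) i j"
    unfolding * ** using carr by (intro entry_minus[of _ m n]) auto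
  finally show ?thesis
    using carr S by (simp only: entry_diagonal_mult[of S' m n _ n] entry_mult_diagonal[of _ m m S n]
        mult_carrier_mat transpose_carrier_mat)
qed

lemma entry_svd_difference_transpose:
  assumes U: "orth_mat m U" "orth_mat m U'" and V: "orth_mat n V" "orth_mat n V'"
    and S: "S \<in> carrier_mat m n" "diagonal_mat S" "S' \<in> carrier_mat m n" "diagonal_mat S'"
  shows "entry (transpose_mat V' * transpose_mat (U' * S' * transpose_mat V' - U * S * transpose_mat V) * U) i j =
    entry S' i i * entry (transpose_mat U' * U) i j - entry (transpose_mat V' * V) i j * entry S j j"
proof -
  note carr = orth_mat_carrier[OF U(1)] orth_mat_carrier[OF U(2)]
    orth_mat_carrier[OF V(1)] orth_mat_carrier[OF V(2)] S(1,3)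
  have "transpose_mat (U' * S' * transpose_mat V' - U * S * transpose_mat V) =
    V' * transpose_mat S' * transpose_mat U' - V * transpose_mat S * transpose_mat U"
    using carr by (simp add: transpose_minus[of _ m n] transpose_mult[of _ m m _ n] transpose_mult[of _ m n _ n])
  then show ?thesis
    using entry_svd_difference[OF V U, of "transpose_mat S" "transpose_mat S'" i j] S
    by (simp add: diagonal_mat_transpose entry_transpose)
qed

lemma frobenius_norm_two_sided:
  assumes "orth_mat m U" "orth_mat n V" "M \<in> carrier_mat m n" "m \<le> N" "n \<le> N"
  shows "(\<Sum>i<N. \<Sum>j<N. (entry (transpose_mat U * M * V) i j)\<^sup>2) = (frobenius_norm M)\<^sup>2"
proof -
  have UM: "transpose_mat U * M \<in> carrier_mat m n"
    using assms orth_mat_carrier[OF assms(1)] by simp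
  then have "frobenius_norm (transpose_mat U * M * V) = frobenius_norm M"
    using assms by (simp only: frobenius_norm_mult_orth[of n V _ m] frobenius_norm_orth_mult[of m _ _ n]
        orth_mat_transpose)
  then show ?thesis
    using frobenius_norm_square[of "transpose_mat U * M * V" N] assms UM
      orth_mat_carrier[OF assms(1)] orth_mat_carrier[OF assms(2)] by (simp del: assoc_mult_mat)
qed

text \<open>On rows up to \<open>p\<close> and columns from \<open>p\<close> on,
  \<open>s' i - s j\<close> is at least \<open>s' p - s p\<close>, while \<open>W\<close> and
  \<open>Z\<close> each have mass at least 1 there. As \<open>F\<close> and \<open>G\<close> have
  total mass \<open>2 * e\<^sup>2\<close>, the difference cannot exceed \<open>e\<close>.\<close>

lemma singular_value_perturbation:
  assumes A: "A \<in> carrier_mat m n" and B: "B \<in> carrier_mat m n"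
  shows "singular_value (p + 1) B \<le> singular_value (p + 1) A + frobenius_norm (B - A)"
proof (rule ccontr)
  assume contr: "\<not> ?thesis"
  obtain U S V where svd: "is_svd A U S V" using svd_exists by blast
  obtain U' S' V' where svd': "is_svd B U' S' V'" using svd_exists by blast
  note S = is_svdD[OF svd A] and S' = is_svdD[OF svd' B]
  note carr = orth_mat_carrier[OF S(1)] orth_mat_carrier[OF S(2)]
    orth_mat_carrier[OF S'(1)] orth_mat_carrier[OF S'(2)]
  define s s' where "s i = entry S i i" and "s' i = entry S' i i" for i
  have gap: "frobenius_norm (B - A) < s' p - s p"
    using contr unfolding singular_value_svd[OF svd A] singular_value_svd[OF svd' B] s_def s'_def by simp
  moreover have "0 \<le> s p" using S(6) by (simp add: s_def)
  ultimately have "s' p > 0" using frobenius_norm_nonneg[of "B - A"] by simp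
  \<comment> \<open>A nonzero padded entry lies inside the matrix; this puts \<open>p\<close> in
    range for both orthogonal factors.\<close>
  then have p: "p < m" "p < n" using S'(3) by (auto simp: s'_def entry_def split: if_splits)
  define W Z F G where "W = transpose_mat U' * U" and "Z = transpose_mat V' * V"
    and "F = transpose_mat U' * (B - A) * V" and "G = transpose_mat V' * transpose_mat (B - A) * U"
  have W: "orth_mat m W" and Z: "orth_mat n Z"
    using S S' by (auto simp: W_def Z_def intro!: orth_mat_mult orth_mat_transpose)
  have F: "entry F i j = s' i * entry Z i j - s j * entry W i j"
    and G: "entry G i j = s' i * entry W i j - s j * entry Z i j" for i j
    using entry_svd_difference[OF S(1) S'(1) S(2) S'(2) S(3,4) S'(3,4), of i j]
      entry_svd_difference_transpose[OF S(1) S'(1) S(2) S'(2) S(3,4) S'(3,4), of i j]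
    unfolding S(5)[symmetric] S'(5)[symmetric] F_def G_def W_def Z_def s_def s'_def by simp_all
  define N where "N = max m n"
  define e where "e = frobenius_norm (B - A)"
  have e: "0 \<le> e" using frobenius_norm_nonneg by (simp add: e_def)
  have BA: "B - A \<in> carrier_mat m n" using A by auto
  have FG: "(\<Sum>i<N. \<Sum>j<N. (entry F i j)\<^sup>2) = e\<^sup>2" "(\<Sum>i<N. \<Sum>j<N. (entry G i j)\<^sup>2) = e\<^sup>2"
    unfolding F_def G_def e_def using S S' BA frobenius_norm_two_sided[of n V' m U "transpose_mat (B - A)" N]
    by (auto simp: N_def frobenius_norm_transpose intro!: frobenius_norm_two_sided simp del: assoc_mult_mat)
  have "(s' p - s p)\<^sup>2 * 2 \<le> (s' p - s p)\<^sup>2 *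
      ((\<Sum>i\<le>p. \<Sum>j\<in>{p..<N}. (entry Z i j)\<^sup>2) + (\<Sum>i\<le>p. \<Sum>j\<in>{p..<N}. (entry W i j)\<^sup>2))"
    using orth_mat_block_sum_ge_1[OF W p(1), of N] orth_mat_block_sum_ge_1[OF Z p(2), of N]
    by (intro mult_left_mono) (auto simp: N_def)
  also have "\<dots> = (\<Sum>i\<le>p. \<Sum>j\<in>{p..<N}. (s' p - s p)\<^sup>2 * ((entry Z i j)\<^sup>2 + (entry W i j)\<^sup>2))"
    by (simp add: sum.distrib sum_distrib_left distrib_left)
  also have "\<dots> \<le> (\<Sum>i\<le>p. \<Sum>j\<in>{p..<N}. (entry F i j)\<^sup>2 + (entry G i j)\<^sup>2)"
  proof (intro sum_mono)
    fix i j assume "i \<in> {..p}" "j \<in> {p..<N}"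
    then have ord: "s' p \<le> s' i" "s j \<le> s p" "0 \<le> s j" "0 \<le> s' i"
      using S(6,7) S'(6,7) by (auto simp: s_def s'_def)
    then have "(s' p - s p)\<^sup>2 * ((entry Z i j)\<^sup>2 + (entry W i j)\<^sup>2)
        \<le> (s' i - s j)\<^sup>2 * ((entry Z i j)\<^sup>2 + (entry W i j)\<^sup>2)"
      using gap frobenius_norm_nonneg[of "B - A"] by (intro mult_right_mono power_mono) auto
    also have "\<dots> \<le> (entry F i j)\<^sup>2 + (entry G i j)\<^sup>2"
      unfolding F G using ord by (intro coupled_entry_bound)
    finally show "(s' p - s p)\<^sup>2 * ((entry Z i j)\<^sup>2 + (entry W i j)\<^sup>2) \<le> (entry F i j)\<^sup>2 + (entry G i j)\<^sup>2" .
  qed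
  also have "\<dots> \<le> (\<Sum>i\<le>p. \<Sum>j<N. (entry F i j)\<^sup>2 + (entry G i j)\<^sup>2)"
    by (intro sum_mono sum_mono2) auto
  also have "\<dots> \<le> (\<Sum>i<N. \<Sum>j<N. (entry F i j)\<^sup>2 + (entry G i j)\<^sup>2)"
    using p by (intro sum_mono2) (auto simp: N_def intro!: sum_nonneg)
  also have "\<dots> = 2 * e\<^sup>2" by (simp add: sum.distrib FG)
  finally have "(s' p - s p)\<^sup>2 \<le> e\<^sup>2" by simp
  then show False using gap e by (simp add: e_def power2_le_iff_abs_le)
qed

section \<open>Perturbation of the truncation\<close>

text \<open>By \<open>svd_exists\<close> the choice in \<open>best_rank_approx\<close> ranges over a
  nonempty set, so the chosen matrix comes from some decomposition.\<close>

lemma best_rank_approx_svd: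
  obtains U S V where "is_svd A U S V" "best_rank_approx k A = U * truncate_diag k S * transpose_mat V"
proof -
  have "\<exists>B U S V. is_svd A U S V \<and> B = U * truncate_diag k S * transpose_mat V"
    using svd_exists by blast
  from someI_ex[OF this] show thesis
    using that unfolding best_rank_approx_def by blast
qed

lemma truncate_diag_carrier: "S \<in> carrier_mat m n \<Longrightarrow> truncate_diag k S \<in> carrier_mat m n"
  by (auto simp: truncate_diag_def)

lemma diagonal_truncate_diag: "diagonal_mat S \<Longrightarrow> diagonal_mat (truncate_diag k S)"
  by (auto simp: truncate_diag_def diagonal_mat_def)

lemma entry_truncate_diag: "entry (truncate_diag k S) i i = (if i < k then entry S i i else 0)"
  by (auto simp: truncate_diag_def entry_def)

lemma best_rank_approx_perturbation:
  assumes A: "A \<in> carrier_mat m n" and E: "E \<in> carrier_mat m n" and k: "k \<ge> 1"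
    and gap: "singular_value (k + 1) A \<le> 1 / 4 * singular_value k A"
    and small: "frobenius_norm E < 1 / 4 * singular_value k A"
  shows "frobenius_norm (best_rank_approx k (A + E) - best_rank_approx k A) \<le> 3 * frobenius_norm E"
proof -
  define B where "B = A + E"
  have B: "B \<in> carrier_mat m n" and BA: "B - A = E" and AB: "frobenius_norm (A - B) = frobenius_norm E"
    using A E by (auto simp: B_def frobenius_norm_def intro!: arg_cong[where f = sqrt] sum.cong)
  obtain U S V where svd: "is_svd A U S V"
    and PA: "best_rank_approx k A = U * truncate_diag k S * transpose_mat V"
    by (rule best_rank_approx_svd)
  obtain U' S' V' where svd': "is_svd B U' S' V'"
    and PB: "best_rank_approx k B = U' * truncate_diag k S' * transpose_mat V'"
    by (rule best_rank_approx_svd)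
  note S = is_svdD[OF svd A] and S' = is_svdD[OF svd' B]
  note carr = orth_mat_carrier[OF S(1)] orth_mat_carrier[OF S(2)]
    orth_mat_carrier[OF S'(1)] orth_mat_carrier[OF S'(2)]
  define s s' where "s i = entry S i i" and "s' i = entry S' i i" for i
  have sv: "singular_value (i + 1) A = s i" "singular_value (i + 1) B = s' i" for i
    using singular_value_svd[OF svd A] singular_value_svd[OF svd' B] by (auto simp: s_def s'_def)
  define \<sigma> where "\<sigma> = singular_value k A"
  \<comment> \<open>Singular values are counted from 1 and diagonal entries from 0, so the gap lies
    between \<open>s (k - 1)\<close> and \<open>s k\<close>.\<close>
  have sk: "s (k - 1) = \<sigma>" using sv(1)[of "k - 1"] k by (simp add: \<sigma>_def)
  have "s k \<le> \<sigma> / 4" using gap sv(1)[of k] by (simp add: \<sigma>_def)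
  moreover have "s' k \<le> s k + frobenius_norm E" "s (k - 1) \<le> s' (k - 1) + frobenius_norm E"
    using singular_value_perturbation[OF A B, of k] singular_value_perturbation[OF B A, of "k - 1"]
    unfolding sv BA AB by auto
  \<comment> \<open>The perturbation moves each value by less than \<sigma>/4: upwards from at most
    \<sigma>/4 at index \<open>k\<close>, downwards from \<sigma> at index
    \<open>k - 1\<close>.\<close>
  ultimately have gaps: "s k \<le> \<sigma> / 4" "s' k \<le> \<sigma> / 2" "3 / 4 * \<sigma> \<le> s' (k - 1)" "0 < \<sigma>"
    using small frobenius_norm_nonneg[of E] sk by (auto simp: \<sigma>_def)
  have mono: "s j \<le> s i" "s' j \<le> s' i" if "i \<le> j" for i j
    using S(7) S'(7) that by (auto simp: s_def s'_def)
  have nonneg: "0 \<le> s i" "0 \<le> s' i" for i using S(6) S'(6) by (auto simp: s_def s'_def)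
  define D where "D = best_rank_approx k B - best_rank_approx k A"
  have DC: "D \<in> carrier_mat m n"
    unfolding D_def PA using carr S(3) by (auto simp: truncate_diag_carrier)
  define W Z F G H where "W = transpose_mat U' * U" and "Z = transpose_mat V' * V"
    and "F = transpose_mat U' * (B - A) * V" and "G = transpose_mat V' * transpose_mat (B - A) * U"
    and "H = transpose_mat U' * D * V"
  have F: "entry F i j = s' i * entry Z i j - s j * entry W i j"
    and G: "entry G i j = s' i * entry W i j - s j * entry Z i j" for i j
    using entry_svd_difference[OF S(1) S'(1) S(2) S'(2) S(3,4) S'(3,4), of i j]
      entry_svd_difference_transpose[OF S(1) S'(1) S(2) S'(2) S(3,4) S'(3,4), of i j]
    unfolding S(5)[symmetric] S'(5)[symmetric] F_def G_def W_def Z_def s_def s'_def by simp_all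
  have H: "entry H i j = (if i < k then s' i else 0) * entry Z i j - entry W i j * (if j < k then s j else 0)" for i j
    unfolding H_def D_def PA PB Z_def W_def s_def s'_def entry_truncate_diag[symmetric]
    using S S' by (intro entry_svd_difference truncate_diag_carrier diagonal_truncate_diag)
  define N where "N = max m n"
  define e where "e = frobenius_norm E"
  have EC: "B - A \<in> carrier_mat m n" using E by (simp add: BA)
  have FG: "(\<Sum>i<N. \<Sum>j<N. (entry F i j)\<^sup>2) = e\<^sup>2" "(\<Sum>i<N. \<Sum>j<N. (entry G i j)\<^sup>2) = e\<^sup>2"
    unfolding F_def G_def e_def BA[symmetric]
    using S S' EC frobenius_norm_two_sided[of n V' m U "transpose_mat (B - A)" N]
    by (auto simp: N_def frobenius_norm_transpose intro!: frobenius_norm_two_sided simp del: assoc_mult_mat)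
  have "(frobenius_norm D)\<^sup>2 = (\<Sum>i<N. \<Sum>j<N. (entry H i j)\<^sup>2)"
    unfolding H_def using S S' DC by (intro frobenius_norm_two_sided[symmetric]) (auto simp: N_def)
  also have "\<dots> \<le> (\<Sum>i<N. \<Sum>j<N. 4 * ((entry F i j)\<^sup>2 + (entry G i j)\<^sup>2))"
  proof (intro sum_mono)
    fix i j
    consider "i < k" "j < k" | "i < k" "k \<le> j" | "k \<le> i" "j < k" | "k \<le> i" "k \<le> j" by linarith
    then show "(entry H i j)\<^sup>2 \<le> 4 * ((entry F i j)\<^sup>2 + (entry G i j)\<^sup>2)"
    proof cases
      case 1
      then have "entry H i j = entry F i j" by (simp add: H F)
      then show ?thesis by simp
    next
      case 2
      then have "i \<le> k - 1" by simp
      \<comment> \<open>\<open>s j\<close> is at most \<sigma>/4, and \<open>s' i\<close> at least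
        3\<sigma>/4.\<close>
      then have "s j \<le> s' i / 2"
        using gaps mono(1)[OF \<open>k \<le> j\<close>] mono(2)[of i "k - 1"] by linarith
      from coupled_entry_bound_half[OF nonneg(1) this, of "entry Z i j" "entry W i j"] show ?thesis
        using 2 by (simp add: H F G)
    next
      case 3
      then have "j \<le> k - 1" by simp
      \<comment> \<open>\<open>s' i\<close> is at most \<sigma>/2, and \<open>s j\<close> at least
        \<sigma>.\<close>
      then have "s' i \<le> s j / 2"
        using gaps sk mono(2)[OF \<open>k \<le> i\<close>] mono(1)[of j "k - 1"] by linarith
      \<comment> \<open>With the roles of the two values and of \<open>W\<close> and
        \<open>Z\<close> exchanged, the differences are the negatives of the entries of
        \<open>F\<close> and \<open>G\<close>; squaring removes the signs.\<close>
      from coupled_entry_bound_half[OF nonneg(2) this, of "entry W i j" "entry Z i j"] show ?thesis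
        using 3 by (simp add: H F G power2_commute mult.commute)
    next
      case 4
      then show ?thesis by (simp add: H)
    qed
  qed
  \<comment> \<open>\<open>F\<close> and \<open>G\<close> contribute \<open>e\<^sup>2\<close> each;
    8 is then rounded up to the square of 3.\<close>
  also have "\<dots> = 8 * e\<^sup>2"
    by (simp add: FG sum.distrib flip: sum_distrib_left)
  also have "\<dots> \<le> (3 * e)\<^sup>2" by (simp add: power_mult_distrib)
  finally have "frobenius_norm D \<le> 3 * e"
    by (rule power2_le_imp_le) (simp add: e_def frobenius_norm_nonneg)
  then show ?thesis by (simp add: D_def e_def B_def)
qed

theorem lemma3:
  shows "\<exists>c::real. \<forall>(m::nat) (n::nat) (k::nat) (A::real mat) (E::real mat).
    A \<in> carrier_mat m n \<longrightarrow> E \<in> carrier_mat m n \<longrightarrow> k \<ge> 1 \<longrightarrow>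
    singular_value (k + 1) A \<le> 1 / 4 * singular_value k A \<longrightarrow>
    frobenius_norm E < 1 / 4 * singular_value k A \<longrightarrow>
    frobenius_norm (best_rank_approx k (A + E) - best_rank_approx k A)
      \<le> c * (sqrt (real k) * op_norm E + frobenius_norm E)"
proof (intro exI[of _ 3] allI impI)
  fix m n k :: nat and A E :: "real mat"
  assume "A \<in> carrier_mat m n" "E \<in> carrier_mat m n" "k \<ge> 1"
    "singular_value (k + 1) A \<le> 1 / 4 * singular_value k A"
    "frobenius_norm E < 1 / 4 * singular_value k A"
  then have "frobenius_norm (best_rank_approx k (A + E) - best_rank_approx k A) \<le> 3 * frobenius_norm E"
    by (rule best_rank_approx_perturbation)
  also have "\<dots> \<le> 3 * (sqrt (real k) * op_norm E + frobenius_norm E)"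
    using op_norm_nonneg by simp
  finally show "frobenius_norm (best_rank_approx k (A + E) - best_rank_approx k A)
      \<le> 3 * (sqrt (real k) * op_norm E + frobenius_norm E)" .
qed

end
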